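(* Let $G$ be a one-step $W$-groupoid and let $e,f\in G$ with $e\neq f$, $ef\neq fe$ and $G=\langle e,f\rangle$. If $\|e\|=2$, then $G$ is isomorphic to the quasigroup with four elements $e,f,ef,fe$ and the following Cayley table (the entry in row $x$ and column $y$ is the product $xy$): $$\begin{array}{c|cccc} & e & f & ef & fe\\ \hline e & e & ef & fe & f\\ f & fe & f & e & ef\\ ef & f & fe & ef & e\\ fe & ef & e & f & fe \end{array}$$
   Context: A groupoid is a set with a binary operation, written by juxtaposition. $W$ is the variety of idempotent right modular groupoids, i.e. groupoids satisfying $xx=x$ and $(xy)z=(zy)x$ for all $x,y,z$. A one-step $W$-groupoid is a non-commutative groupoid $G\in W$ (finite or infinite) such that every proper subgroupoid of $G$ is commutative. $\langle x,y\rangle$ denotes the subgroupoid generated by $x$ and $y$. In the situation of the claim, put $g=ef$; then it is known that $G=\langle f,g\rangle$. A word is a finite product of terms, each equal to $f$ or to $g=ef$, bracketed in any meaningful manner; its length is the number of such terms (counted with repetition, each occurrence of $f$ or of $ef$ counting as one term). For $x\in G$, $\|x\|$ denotes the minimum length of a word representing $x$. The number $\|e\|$ is called the dimension of $G$. *)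

theory Defs
  imports Main "HOL-Library.Extended_Nat"
begin

definition groupoid :: "'a set \<Rightarrow> ('a \<Rightarrow> 'a \<Rightarrow> 'a) \<Rightarrow> bool" where
  "groupoid G m \<longleftrightarrow> (\<forall>x\<in>G. \<forall>y\<in>G. m x y \<in> G)"

definition W_groupoid :: "'a set \<Rightarrow> ('a \<Rightarrow> 'a \<Rightarrow> 'a) \<Rightarrow> bool" where
  "W_groupoid G m \<longleftrightarrow> groupoid G m \<and>
     (\<forall>x\<in>G. m x x = x) \<and>
     (\<forall>x\<in>G. \<forall>y\<in>G. \<forall>z\<in>G. m (m x y) z = m (m z y) x)"

definition subgroupoid :: "'a set \<Rightarrow> 'a set \<Rightarrow> ('a \<Rightarrow> 'a \<Rightarrow> 'a) \<Rightarrow> bool" where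
  "subgroupoid H G m \<longleftrightarrow> H \<subseteq> G \<and> groupoid H m"

definition commutative_on :: "'a set \<Rightarrow> ('a \<Rightarrow> 'a \<Rightarrow> 'a) \<Rightarrow> bool" where
  "commutative_on H m \<longleftrightarrow> (\<forall>x\<in>H. \<forall>y\<in>H. m x y = m y x)"

definition one_step_W_groupoid :: "'a set \<Rightarrow> ('a \<Rightarrow> 'a \<Rightarrow> 'a) \<Rightarrow> bool" where
  "one_step_W_groupoid G m \<longleftrightarrow> W_groupoid G m \<and> \<not> commutative_on G m \<and>
     (\<forall>H. subgroupoid H G m \<and> H \<noteq> G \<longrightarrow> commutative_on H m)"

definition generated :: "'a set \<Rightarrow> ('a \<Rightarrow> 'a \<Rightarrow> 'a) \<Rightarrow> 'a set \<Rightarrow> 'a set" where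
  "generated G m X = \<Inter>{H. subgroupoid H G m \<and> X \<subseteq> H}"

datatype 'a word = Term 'a | Prod "'a word" "'a word"

primrec word_value :: "('a \<Rightarrow> 'a \<Rightarrow> 'a) \<Rightarrow> 'a word \<Rightarrow> 'a" where
  "word_value m (Term a) = a"
| "word_value m (Prod u v) = m (word_value m u) (word_value m v)"

primrec word_length :: "'a word \<Rightarrow> nat" where
  "word_length (Term a) = 1"
| "word_length (Prod u v) = word_length u + word_length v"

text \<open>The norm of \<open>x\<close>, relative to words in the terms \<open>f\<close> and \<open>ef\<close>; it is infinite
  if no such word represents \<open>x\<close>.\<close>

definition word_norm :: "('a \<Rightarrow> 'a \<Rightarrow> 'a) \<Rightarrow> 'a \<Rightarrow> 'a \<Rightarrow> 'a \<Rightarrow> enat" where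
  "word_norm m e f x =
     (INF w \<in> {w. set_word w \<subseteq> {f, m e f} \<and> word_value m w = x}. enat (word_length w))"

definition groupoid_iso ::
  "('a \<Rightarrow> 'b) \<Rightarrow> 'a set \<Rightarrow> ('a \<Rightarrow> 'a \<Rightarrow> 'a) \<Rightarrow> 'b set \<Rightarrow> ('b \<Rightarrow> 'b \<Rightarrow> 'b) \<Rightarrow> bool" where
  "groupoid_iso h G m G' m' \<longleftrightarrow> bij_betw h G G' \<and>
     (\<forall>x\<in>G. \<forall>y\<in>G. h (m x y) = m' (h x) (h y))"

datatype quad = Qe | Qf | Qef | Qfe

fun quad_mult :: "quad \<Rightarrow> quad \<Rightarrow> quad" where
  "quad_mult Qe  Qe = Qe"  | "quad_mult Qe  Qf = Qef" | "quad_mult Qe  Qef = Qfe" | "quad_mult Qe  Qfe = Qf"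
| "quad_mult Qf  Qe = Qfe" | "quad_mult Qf  Qf = Qf"  | "quad_mult Qf  Qef = Qe"  | "quad_mult Qf  Qfe = Qef"
| "quad_mult Qef Qe = Qf"  | "quad_mult Qef Qf = Qfe" | "quad_mult Qef Qef = Qef" | "quad_mult Qef Qfe = Qe"
| "quad_mult Qfe Qe = Qef" | "quad_mult Qfe Qf = Qe"  | "quad_mult Qfe Qef = Qf"  | "quad_mult Qfe Qfe = Qfe"

lemma quad_quasigroup: "(\<exists>!x. quad_mult a x = b) \<and> (\<exists>!y. quad_mult y a = b)"
proof -
  have all: "(\<forall>x. P x) \<longleftrightarrow> P Qe \<and> P Qf \<and> P Qef \<and> P Qfe" for P
    by (metis quad.exhaust)
  have ex: "(\<exists>x. P x) \<longleftrightarrow> P Qe \<or> P Qf \<or> P Qef \<or> P Qfe" for P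
    by (metis quad.exhaust)
  show ?thesis
    unfolding Ex1_def ex all by (cases a; cases b; simp)
qed

end

theory Submission
  imports Defs
begin

text \<open>Write \<open>g = ef\<close> and \<open>h = fe\<close>. A word of length two representing \<open>e\<close> gives \<open>e = gf\<close> or
  \<open>e = fg\<close>. Always \<open>gf = h\<close>, so in the first case \<open>e = h\<close>, and then \<open>{e, g}\<close> is a proper
  non-commutative subgroupoid, a contradiction. In the second case put \<open>k = ge\<close>. The identities of
  \<open>W\<close> alone show that \<open>{e, k, g, h}\<close> is closed under multiplication, with the required table in
  which \<open>k\<close> plays the role of \<open>f\<close>. As \<open>ek = g\<close> and \<open>ke = h\<close> do not commute, this subgroupoid is all of
  \<open>G\<close>; hence it contains \<open>f\<close>, and this forces \<open>f = k\<close>.\<close>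

lemma word_length_pos: "0 < word_length w"
  by (induction w) auto

lemma word_length_1: "word_length w = 1 \<longleftrightarrow> (\<exists>a. w = Term a)"
proof (cases w)
  case (Prod u v)
  then show ?thesis
    using word_length_pos[of u] word_length_pos[of v] by auto
qed auto

lemma word_length_2: "word_length w = 2 \<longleftrightarrow> (\<exists>a b. w = Prod (Term a) (Term b))"
proof (cases w)
  case (Prod u v)
  have "word_length u + word_length v = 2 \<longleftrightarrow> word_length u = 1 \<and> word_length v = 1"
    using word_length_pos[of u] word_length_pos[of v] by arith
  then show ?thesis
    using Prod by (auto simp: word_length_1[unfolded One_nat_def])
qed auto

text \<open>In \<open>enat\<close> the infimum of the empty set is infinity and that of a nonempty
  set is its least element, so a finite norm is attained.\<close>

lemma word_norm_attained:
  assumes "word_norm m e f x = enat n"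
  obtains w where "set_word w \<subseteq> {f, m e f}" "word_value m w = x" "word_length w = n"
proof -
  let ?S = "(\<lambda>w. enat (word_length w)) ` {w. set_word w \<subseteq> {f, m e f} \<and> word_value m w = x}"
  have inf: "Inf ?S = enat n"
    using assms by (simp add: word_norm_def)
  then have ne: "?S \<noteq> {}"
    by (auto simp: Inf_enat_def split: if_splits)
  then obtain y where "y \<in> ?S"
    by blast
  then have "(LEAST y. y \<in> ?S) \<in> ?S"
    by (rule LeastI)
  then have "Inf ?S \<in> ?S"
    unfolding Inf_enat_def if_not_P[OF ne] .
  then show ?thesis
    using inf that by auto
qed

lemma word_norm_2E:
  assumes "word_norm m e f x = 2"
  obtains a b where "a \<in> {f, m e f}" "b \<in> {f, m e f}" "m a b = x"
proof -
  have "word_norm m e f x = enat 2"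
    using assms by (simp add: numeral_eq_enat)
  then obtain w where w: "set_word w \<subseteq> {f, m e f}" "word_value m w = x" "word_length w = 2"
    by (rule word_norm_attained)
  from w(3) obtain a b where "w = Prod (Term a) (Term b)"
    by (auto simp: word_length_2)
  with w that show ?thesis by auto
qed

locale W_groupoid_on =
  fixes G :: "'a set" and m :: "'a \<Rightarrow> 'a \<Rightarrow> 'a" (infixl \<open>\<cdot>\<close> 70)
  assumes W: "W_groupoid G m"
begin

lemma closed [simp]: "x \<in> G \<Longrightarrow> y \<in> G \<Longrightarrow> x \<cdot> y \<in> G"
  using W by (auto simp: W_groupoid_def groupoid_def)

lemma idem [simp]: "x \<in> G \<Longrightarrow> x \<cdot> x = x"
  using W by (auto simp: W_groupoid_def)

lemma right_modular: "x \<in> G \<Longrightarrow> y \<in> G \<Longrightarrow> z \<in> G \<Longrightarrow> x \<cdot> y \<cdot> z = z \<cdot> y \<cdot> x"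
  using W by (auto simp: W_groupoid_def)

text \<open>Right modularity turns \<open>xyy\<close> into \<open>yyx\<close>, which idempotence
  shortens.\<close>

lemma mult_mult_same: "x \<in> G \<Longrightarrow> y \<in> G \<Longrightarrow> x \<cdot> y \<cdot> y = y \<cdot> x"
  by (simp add: right_modular[of x y y])

text \<open>Three exchanges of outer factors: (xy)(zw) = ((zw)y)x = ((yw)z)x = (xz)(yw).\<close>

lemma medial:
  assumes "x \<in> G" "y \<in> G" "z \<in> G" "w \<in> G"
  shows "(x \<cdot> y) \<cdot> (z \<cdot> w) = (x \<cdot> z) \<cdot> (y \<cdot> w)"
  using assms right_modular[of x y "z \<cdot> w"] right_modular[of z w y] right_modular[of "y \<cdot> w" z x]
  by simp

text \<open>Mediality, with \<open>x\<close> expanded to \<open>xx\<close>.\<close>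

lemma elastic: "x \<in> G \<Longrightarrow> y \<in> G \<Longrightarrow> x \<cdot> (y \<cdot> x) = x \<cdot> y \<cdot> x"
  using medial[of x x y x] by simp

end

lemma one_step_subgroupoid_eq:
  assumes "one_step_W_groupoid G m" "H \<subseteq> G" "groupoid H m"
    and "x \<in> H" "y \<in> H" "m x y \<noteq> m y x"
  shows "H = G"
  using assms unfolding one_step_W_groupoid_def subgroupoid_def commutative_on_def by metis

theorem theorem16:
  fixes G :: "'a set" and m :: "'a \<Rightarrow> 'a \<Rightarrow> 'a" and e f :: 'a
  assumes "one_step_W_groupoid G m"
    and "e \<in> G" and "f \<in> G"
    and "e \<noteq> f"
    and "m e f \<noteq> m f e"
    and "G = generated G m {e, f}"
    and "word_norm m e f e = 2"
  shows "\<exists>h. groupoid_iso h G m UNIV quad_mult \<and>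
           h e = Qe \<and> h f = Qf \<and> h (m e f) = Qef \<and> h (m f e) = Qfe"
proof -
  interpret W_groupoid_on G m
    using assms(1) by unfold_locales (simp add: one_step_W_groupoid_def)
  define g where "g = m e f"
  define h where "h = m f e"
  have in_G [simp]: "e \<in> G" "f \<in> G" "g \<in> G" "h \<in> G"
    using assms(2,3) by (simp_all add: g_def h_def)
  have ef: "m e f = g" and fe: "m f e = h"
    by (simp_all add: g_def h_def)
  have gf: "m g f = h"
    using mult_mult_same[of e f] by (simp add: ef fe)
  have he: "m h e = g"
    using mult_mult_same[of f e] by (simp add: ef fe)
  have gh_ne: "g \<noteq> h"
    using assms(5) by (simp add: ef fe)
  have "g \<noteq> f"
    using gf gh_ne by auto
  have "e \<noteq> g"
    using gf ef gh_ne by auto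
  have "e \<noteq> h"
  proof
    assume eh: "e = h"
    \<comment> \<open>With \<open>fe = e\<close>, this is (ef)e = e(fe) = ee.\<close>
    have ge: "m g e = e"
      using elastic[of e f] by (simp add: ef fe eh[symmetric])
    have eg: "m e g = g"
      using right_modular[of f e g] by (simp add: ef fe eh[symmetric] ge)
    have "groupoid {e, g} m"
      by (simp add: groupoid_def ge eg)
    then have "{e, g} = G"
      by (rule one_step_subgroupoid_eq[OF assms(1), where x = e and y = g, rotated])
        (use ge eg \<open>e \<noteq> g\<close> in auto)
    with \<open>g \<noteq> f\<close> \<open>e \<noteq> f\<close> show False
      using in_G(2) by blast
  qed
  obtain a b where "a \<in> {f, m e f}" "b \<in> {f, m e f}" "m a b = e"
    by (rule word_norm_2E[OF assms(7)])
  \<comment> \<open>The other candidates \<open>ff = f\<close>, \<open>gg = g\<close> and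
    \<open>gf = h\<close> all differ from \<open>e\<close>.\<close>
  then have fg: "m f g = e"
    using gf \<open>e \<noteq> f\<close> \<open>e \<noteq> g\<close> \<open>e \<noteq> h\<close> by (auto simp: ef)
  have hf: "m h f = e"
    using elastic[of f e] by (simp add: ef fe fg)
  have "f \<noteq> h"
    using hf \<open>e \<noteq> f\<close> by auto
  have eg: "m e g = h"
    using mult_mult_same[of f g] by (simp add: fg gf)
  have gh: "m g h = e"
    using right_modular[of e f h] by (simp add: ef hf)
  \<comment> \<open>The target table has \<open>f\<close> as the product of \<open>ef\<close> and
    \<open>e\<close>.\<close>
  define k where "k = m g e"
  have kG [simp]: "k \<in> G"
    by (simp add: k_def)
  have ge: "m g e = k"
    by (simp add: k_def)
  \<comment> \<open>The factorizations \<open>k = ge = eh = hg\<close> bring each remaining product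
    of \<open>k\<close> with \<open>e\<close>, \<open>g\<close> or \<open>h\<close> into one of the
    forms x(yx), (xy)x or (xy)y, which \<open>elastic\<close> and \<open>mult_mult_same\<close>
    evaluate.\<close>
  have eh: "m e h = k"
    using elastic[of e f] by (simp add: ef fe ge)
  have hg: "m h g = k"
    using elastic[of g f] by (simp add: fg gf ge)
  have ek: "m e k = g"
    using elastic[of e g] by (simp add: ge eg he)
  have ke: "m k e = h"
    using mult_mult_same[of g e] by (simp add: ge eg)
  have gk: "m g k = h"
    using elastic[of g h] by (simp add: hg gh eg)
  have kg: "m k g = e"
    using mult_mult_same[of h g] by (simp add: hg gh)
  have kh: "m k h = g"
    using elastic[of h g] by (simp add: hg gh he)
  have hk: "m h k = e"
    using elastic[of h e] by (simp add: eh he gh)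
  note table = ge eh hg ek ke gk kg kh hk gh eg he
  have "groupoid {e, k, g, h} m"
    by (simp add: groupoid_def table)
  then have G: "{e, k, g, h} = G"
    by (rule one_step_subgroupoid_eq[OF assms(1), where x = e and y = k, rotated])
      (use ek ke gh_ne in auto)
  have "f = k"
    using in_G(2) \<open>e \<noteq> f\<close> \<open>g \<noteq> f\<close> \<open>f \<noteq> h\<close> by (auto simp: G[symmetric])
  \<comment> \<open>On \<open>G\<close> the last \<open>else\<close> is reached only by
    \<open>h\<close>; values outside \<open>G\<close> do not matter.\<close>
  define \<phi> where "\<phi> x = (if x = e then Qe else if x = k then Qf else if x = g then Qef else Qfe)" for x
  have ne: "e \<noteq> k" "e \<noteq> g" "e \<noteq> h" "k \<noteq> g" "k \<noteq> h" "g \<noteq> h"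
    using \<open>e \<noteq> f\<close> \<open>e \<noteq> g\<close> \<open>e \<noteq> h\<close> \<open>g \<noteq> f\<close> \<open>f \<noteq> h\<close> gh_ne \<open>f = k\<close> by auto
  have \<phi>: "\<phi> e = Qe" "\<phi> k = Qf" "\<phi> g = Qef" "\<phi> h = Qfe"
    using ne by (auto simp: \<phi>_def)
  have "UNIV = {Qe, Qf, Qef, Qfe}"
    using quad.exhaust by blast
  then have "bij_betw \<phi> G UNIV"
    using ne by (simp add: bij_betw_def G[symmetric] \<phi>)
  moreover have "\<forall>x\<in>G. \<forall>y\<in>G. \<phi> (m x y) = quad_mult (\<phi> x) (\<phi> y)"
    unfolding G[symmetric] by (simp add: table \<phi>)
  ultimately show ?thesis
    using \<phi> by (intro exI[of _ \<phi>]) (simp add: groupoid_iso_def \<open>f = k\<close> ek ke)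
qed

end
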